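(* Let $X$ be a foliated space with a transverse invariant measure $\Lambda$. There exists a Borel measure $\widetilde{\Lambda}$ on $X$ such that $\widetilde{\Lambda}(T)=\Lambda(T)$ for every generalized transversal $T$ of $X$.
   Context: A foliated space is a Polish space $X$ covered by countably many open sets $U_i$ with homeomorphisms $\varphi_i:U_i\to T_i\times\mathbb{R}^n$ ($T_i$ Polish, $n$ fixed), such that the changes of coordinates $\varphi_j\circ\varphi_i^{-1}$ are locally of the form $(t,x)\mapsto(f(t),g(t,x))$. The sets $\varphi_i^{-1}(\{t\}\times\mathbb{R}^n)$ are the plaques. The leaf topology on $X$ is the topology for which each $\varphi_i$ is a homeomorphism from the open set $U_i$ onto $T_i\times\mathbb{R}^n$, where $T_i$ carries the discrete topology and $\mathbb{R}^n$ the Euclidean topology. The leaves are the connected components of $X$ in the leaf topology. Measurability in $X$ refers to the Borel $\sigma$-algebra of the original (Polish) topology. A generalized transversal is a Borel subset $T\subset X$ whose intersection with each leaf is countable; $\mathcal{T}(X)$ denotes the set of generalized transversals. A measurable holonomy transformation is a measurable isomorphism $\gamma:T\to T'$ with $T,T'\in\mathcal{T}(X)$ that maps each point to a point in the same leaf. A transverse invariant measure on $X$ is a map $\Lambda:\mathcal{T}(X)\to[0,\infty]$ with $\Lambda(\emptyset)=0$, $\sigma$-additive (i.e. $\Lambda(\bigcup_n T_n)=\sum_n\Lambda(T_n)$ for countable families of pairwise disjoint generalized transversals) and invariant by measurable holonomy transformations (i.e. $\Lambda(T)=\Lambda(T')$ whenever there is a measurable holonomy transformation $T\to T'$). Measures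 take values in $[0,\infty]$ and no $\sigma$-finiteness is assumed. *)

theory Defs
  imports "HOL-Analysis.Analysis"
begin

definition polish_topology :: "'a topology \<Rightarrow> bool" where
  "polish_topology X \<longleftrightarrow> completely_metrizable_space X \<and> second_countable X"

definition borel_of :: "'a topology \<Rightarrow> 'a measure" where
  "borel_of X = sigma (topspace X) {V. openin X V}"

definition measurable_isomorphism :: "'a measure \<Rightarrow> 'b measure \<Rightarrow> ('a \<Rightarrow> 'b) \<Rightarrow> bool" where
  "measurable_isomorphism M N f \<longleftrightarrow>
     bij_betw f (space M) (space N) \<and> f \<in> measurable M N \<and>
     inv_into (space M) f \<in> measurable N M"

text \<open>The model \<open>\<real>\<^sup>n\<close> is \<open>Euclidean_space n\<close>, the space of real sequences vanishing
  from index \<open>n\<close> on, so that \<open>n\<close> is an arbitrary natural number (\<open>n = 0\<close> included).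
  The transversal models \<open>T i\<close> share one carrier type, but they may be different
  topologies on different subsets of it.\<close>

locale foliated_space =
  fixes X :: "'a topology"
    and n :: nat
    and I :: "'i set"
    and U :: "'i \<Rightarrow> 'a set"
    and T :: "'i \<Rightarrow> 'b topology"
    and \<phi> :: "'i \<Rightarrow> 'a \<Rightarrow> 'b \<times> (nat \<Rightarrow> real)"
  assumes polish: "polish_topology X"
    and countable_index: "countable I"
    and chart_open: "\<And>i. i \<in> I \<Longrightarrow> openin X (U i)"
    and cover: "(\<Union>i\<in>I. U i) = topspace X"
    and transversal_polish: "\<And>i. i \<in> I \<Longrightarrow> polish_topology (T i)"
    and chart_homeo: "\<And>i. i \<in> I \<Longrightarrow>
      homeomorphic_map (subtopology X (U i)) (prod_topology (T i) (Euclidean_space n)) (\<phi> i)"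
    and change_of_coordinates: "\<And>i j p. i \<in> I \<Longrightarrow> j \<in> I \<Longrightarrow> p \<in> \<phi> i ` (U i \<inter> U j) \<Longrightarrow>
      \<exists>W f g. openin (prod_topology (T i) (Euclidean_space n)) W \<and>
        p \<in> W \<and> W \<subseteq> \<phi> i ` (U i \<inter> U j) \<and>
        (\<forall>(t, x)\<in>W. \<phi> j (inv_into (U i) (\<phi> i) (t, x)) = (f t, g t x))"
begin

definition is_leaf_topology :: "'a topology \<Rightarrow> bool" where
  "is_leaf_topology L \<longleftrightarrow>
     topspace L = topspace X \<and>
     (\<forall>i\<in>I. openin L (U i) \<and>
        homeomorphic_map (subtopology L (U i))
          (prod_topology (discrete_topology (topspace (T i))) (Euclidean_space n)) (\<phi> i))"

definition leaf_topology :: "'a topology" where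
  "leaf_topology = (THE L. is_leaf_topology L)"

definition leaves :: "'a set set" where
  "leaves = connected_components_of leaf_topology"

definition generalized_transversals :: "'a set set" where
  "generalized_transversals =
     {S \<in> sets (borel_of X). \<forall>F\<in>leaves. countable (S \<inter> F)}"

definition measurable_holonomy :: "'a set \<Rightarrow> 'a set \<Rightarrow> ('a \<Rightarrow> 'a) \<Rightarrow> bool" where
  "measurable_holonomy S S' \<gamma> \<longleftrightarrow>
     S \<in> generalized_transversals \<and> S' \<in> generalized_transversals \<and>
     measurable_isomorphism (restrict_space (borel_of X) S) (restrict_space (borel_of X) S') \<gamma> \<and>
     (\<forall>x\<in>S. \<exists>F\<in>leaves. x \<in> F \<and> \<gamma> x \<in> F)"

text \<open>Only the values of \<open>\<Lambda>\<close> on generalized transversals are constrained.  The proviso in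
  \<open>countably_additive\<close> that the union lies in the family is vacuous here, by
  \<open>generalized_transversals_UN\<close> below.\<close>

definition transverse_invariant_measure :: "('a set \<Rightarrow> ennreal) \<Rightarrow> bool" where
  "transverse_invariant_measure \<Lambda> \<longleftrightarrow>
     \<Lambda> {} = 0 \<and>
     countably_additive generalized_transversals \<Lambda> \<and>
     (\<forall>S S' \<gamma>. measurable_holonomy S S' \<gamma> \<longrightarrow> \<Lambda> S = \<Lambda> S')"

lemma generalized_transversals_UN:
  fixes A :: "nat \<Rightarrow> 'a set"
  assumes "range A \<subseteq> generalized_transversals"
  shows "(\<Union>k. A k) \<in> generalized_transversals"
proof -
  have *: "A k \<in> sets (borel_of X)" "F \<in> leaves \<Longrightarrow> countable (A k \<inter> F)" for k F
    using assms by (auto simp: generalized_transversals_def)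
  have "countable ((\<Union>k. A k) \<inter> F)" if "F \<in> leaves" for F
  proof -
    have "countable (\<Union>k. A k \<inter> F)" using *(2)[OF that] by (intro countable_UN) auto
    then show ?thesis by (simp add: Int_UN_distrib2 Int_commute)
  qed
  then show ?thesis
    using *(1) by (auto simp: generalized_transversals_def)
qed

abbreviation chart_topology :: "'i \<Rightarrow> ('b \<times> (nat \<Rightarrow> real)) topology" where
  "chart_topology i \<equiv> prod_topology (T i) (Euclidean_space n)"

abbreviation leaf_chart_topology :: "'i \<Rightarrow> ('b \<times> (nat \<Rightarrow> real)) topology" where
  "leaf_chart_topology i \<equiv>
     prod_topology (discrete_topology (topspace (T i))) (Euclidean_space n)"

lemma chart_subset: "i \<in> I \<Longrightarrow> U i \<subseteq> topspace X"
  using chart_open openin_subset by blast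

lemma chart_inj: "i \<in> I \<Longrightarrow> inj_on (\<phi> i) (U i)"
  using homeomorphic_imp_injective_map[OF chart_homeo] chart_subset
  by (simp add: topspace_subtopology inf.absorb2)

lemma chart_image: "i \<in> I \<Longrightarrow> \<phi> i ` U i = topspace (T i) \<times> topspace (Euclidean_space n)"
  using homeomorphic_imp_surjective_map[OF chart_homeo] chart_subset
  by (simp add: topspace_subtopology inf.absorb2)

lemma openin_leaf_chart:
  assumes "openin (leaf_chart_topology i) Q"
  shows "openin (Euclidean_space n) {z. (t, z) \<in> Q}"
proof (rule openin_subopen[THEN iffD2, OF ballI])
  fix z assume "z \<in> {z. (t, z) \<in> Q}"
  then have z: "(t, z) \<in> Q" by simp
  obtain A B where "openin (Euclidean_space n) B" "t \<in> A" "z \<in> B" "A \<times> B \<subseteq> Q"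
    using assms[unfolded openin_prod_topology_alt, rule_format, OF z] by blast
  then show "\<exists>B. openin (Euclidean_space n) B \<and> z \<in> B \<and> B \<subseteq> {z. (t, z) \<in> Q}"
    by blast
qed

text \<open>Plaquewise continuity of the changes of coordinates.\<close>

lemma leaf_transition_open:
  assumes i: "i \<in> I" and j: "j \<in> I" and V: "V \<subseteq> U i"
    and open_V: "openin (leaf_chart_topology i) (\<phi> i ` V)"
  shows "openin (leaf_chart_topology j) (\<phi> j ` (V \<inter> U j))"
proof (rule openin_subopen[THEN iffD2, OF ballI])
  fix q assume "q \<in> \<phi> j ` (V \<inter> U j)"
  then obtain x where x: "x \<in> V" "x \<in> U j" and q: "q = \<phi> j x" by blast
  define \<psi> where "\<psi> = inv_into (U j) (\<phi> j)"
  obtain s y where sy: "\<phi> j x = (s, y)" by fastforce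
  have "(s, y) \<in> \<phi> j ` (U j \<inter> U i)" using x V sy by (metis IntI imageI subsetD)
  then obtain W f g where W: "openin (chart_topology j) W" "(s, y) \<in> W"
      "W \<subseteq> \<phi> j ` (U j \<inter> U i)"
    and fg: "\<And>t z. (t, z) \<in> W \<Longrightarrow> \<phi> i (\<psi> (t, z)) = (f t, g t z)"
    using change_of_coordinates[OF j i, of "(s, y)"] unfolding \<psi>_def by blast
  obtain A B where AB: "openin (T j) A" "openin (Euclidean_space n) B" "s \<in> A" "y \<in> B"
      "A \<times> B \<subseteq> W"
    using W(1)[unfolded openin_prod_topology_alt, rule_format, OF W(2)] by blast
  have psi: "\<psi> q \<in> U j \<inter> U i" "\<phi> j (\<psi> q) = q" if q: "q \<in> W" for q
  proof -
    obtain u where u: "u \<in> U j \<inter> U i" "q = \<phi> j u" using q W(3) by blast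
    then have "\<psi> q = u" unfolding \<psi>_def using chart_inj[OF j] by simp
    then show "\<psi> q \<in> U j \<inter> U i" "\<phi> j (\<psi> q) = q" using u by auto
  qed
  have cont_psi: "continuous_map (chart_topology j) (subtopology X (U j)) \<psi>"
  proof -
    obtain h where h: "homeomorphic_maps (subtopology X (U j)) (chart_topology j) (\<phi> j) h"
      using chart_homeo[OF j] homeomorphic_map_maps by blast
    have "h q = \<psi> q" if "q \<in> topspace (chart_topology j)" for q
    proof -
      have "h q \<in> U j" "\<phi> j (h q) = q"
        using h that unfolding homeomorphic_maps_def continuous_map_def by auto
      then show ?thesis unfolding \<psi>_def using chart_inj[OF j] by (metis inv_into_f_f)
    qed
    then show ?thesis using h unfolding homeomorphic_maps_def
      by (meson continuous_map_eq)
  qed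
  have s: "s \<in> topspace (T j)" using AB(1,3) openin_subset by blast
  have cont_slice: "continuous_map (subtopology (Euclidean_space n) B)
      (chart_topology j) (\<lambda>z. (s, z))"
    by (intro continuous_map_pairedI) (auto simp: s continuous_map_from_subtopology)
  have "continuous_map (subtopology (Euclidean_space n) B) X (\<lambda>z. \<psi> (s, z))"
    using continuous_map_compose[OF cont_slice cont_psi] continuous_map_in_subtopology
    by (fastforce simp: o_def)
  moreover have "(\<lambda>z. \<psi> (s, z)) \<in> topspace (subtopology (Euclidean_space n) B) \<rightarrow> U i"
    using AB psi(1) by fastforce
  ultimately have "continuous_map (subtopology (Euclidean_space n) B) (subtopology X (U i))
      (\<lambda>z. \<psi> (s, z))"
    by (simp add: continuous_map_in_subtopology image_subset_iff_funcset)
  from continuous_map_compose[OF this homeomorphic_imp_continuous_map[OF chart_homeo[OF i]]]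
  have "continuous_map (subtopology (Euclidean_space n) B) (Euclidean_space n)
      (\<lambda>z. snd (\<phi> i (\<psi> (s, z))))"
    by (simp add: continuous_map_componentwise o_def continuous_map_pairwise)
  then have cont_g: "continuous_map (subtopology (Euclidean_space n) B) (Euclidean_space n) (g s)"
    by (rule continuous_map_eq) (use AB fg in auto)
  define C where "C = {z \<in> B. g s z \<in> {w. (f s, w) \<in> \<phi> i ` V}}"
  have BE: "B \<subseteq> topspace (Euclidean_space n)" using AB(2) openin_subset by blast
  have "openin (subtopology (Euclidean_space n) B) C"
    using openin_continuous_map_preimage[OF cont_g openin_leaf_chart[OF open_V, of "f s"]] BE
    unfolding C_def by (simp add: inf.absorb2)
  then have C: "openin (Euclidean_space n) C"
    using AB(2) openin_trans_full by blast
  have mem: "\<psi> (s, z) \<in> V" if "z \<in> C" for z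
  proof -
    have sz: "(s, z) \<in> W" using that AB C_def by auto
    then have "\<phi> i (\<psi> (s, z)) \<in> \<phi> i ` V" using that fg C_def by auto
    then show ?thesis using psi(1)[OF sz] chart_inj[OF i] V
      by (metis IntD2 inj_on_image_mem_iff)
  qed
  have "{s} \<times> C \<subseteq> \<phi> j ` (V \<inter> U j)"
  proof clarify
    fix z assume z: "z \<in> C"
    then have sz: "(s, z) \<in> W" using AB C_def by auto
    show "(s, z) \<in> \<phi> j ` (V \<inter> U j)"
      using mem[OF z] psi[OF sz] by (metis IntD1 IntI imageI)
  qed
  moreover have "y \<in> C"
  proof -
    have "\<psi> (s, y) = x" using sy x(2) chart_inj[OF j] unfolding \<psi>_def by (metis inv_into_f_f)
    then have "(f s, g s y) = \<phi> i x" using fg[OF W(2)] by simp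
    then show ?thesis using AB(4) x(1) by (simp add: C_def)
  qed
  moreover have "openin (leaf_chart_topology j) ({s} \<times> C)"
    using C s by (simp add: openin_prod_Times_iff)
  ultimately show "\<exists>Q. openin (leaf_chart_topology j) Q \<and> q \<in> Q \<and> Q \<subseteq> \<phi> j ` (V \<inter> U j)"
    using sy q by auto
qed

lemma is_leaf_topology_openin:
  assumes L: "is_leaf_topology L"
  shows "openin L V \<longleftrightarrow>
    V \<subseteq> topspace X \<and> (\<forall>i\<in>I. openin (leaf_chart_topology i) (\<phi> i ` (V \<inter> U i)))"
proof -
  have piece: "openin L (V \<inter> U i) \<longleftrightarrow> openin (leaf_chart_topology i) (\<phi> i ` (V \<inter> U i))"
    if i: "i \<in> I" for i
  proof -
    have U: "openin L (U i)" and h: "homeomorphic_map (subtopology L (U i))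
        (leaf_chart_topology i) (\<phi> i)"
      using L i unfolding is_leaf_topology_def by auto
    have "V \<inter> U i \<subseteq> topspace (subtopology L (U i))" using openin_subset[OF U] by auto
    from homeomorphic_map_openness[OF h this] show ?thesis
      using U openin_open_subtopology by fastforce
  qed
  have top: "topspace L = topspace X" and "\<And>i. i \<in> I \<Longrightarrow> openin L (U i)"
    using L unfolding is_leaf_topology_def by auto
  then have "openin L V \<longleftrightarrow> V \<subseteq> topspace X \<and> (\<forall>i\<in>I. openin L (V \<inter> U i))"
  proof (intro iffI conjI ballI)
    assume *: "V \<subseteq> topspace X \<and> (\<forall>i\<in>I. openin L (V \<inter> U i))"
    then have "V = (\<Union>i\<in>I. V \<inter> U i)" using cover by blast
    moreover have "openin L (\<Union>i\<in>I. V \<inter> U i)" using * by blast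
    ultimately show "openin L V" by simp
  qed (use openin_subset in fastforce)+
  then show ?thesis using piece by auto
qed

theorem leaf_topology_exists_unique: "\<exists>!L. is_leaf_topology L"
proof (rule ex_ex1I)
  define P where "P V \<longleftrightarrow> V \<subseteq> topspace X \<and>
    (\<forall>i\<in>I. openin (leaf_chart_topology i) (\<phi> i ` (V \<inter> U i)))" for V
  have "istopology P"
    unfolding istopology_def P_def
  proof (intro conjI allI impI ballI)
    fix S S' i assume S: "S \<subseteq> topspace X \<and> (\<forall>i\<in>I. openin (leaf_chart_topology i) (\<phi> i ` (S \<inter> U i)))"
      "S' \<subseteq> topspace X \<and> (\<forall>i\<in>I. openin (leaf_chart_topology i) (\<phi> i ` (S' \<inter> U i)))" and i: "i \<in> I"
    have "\<phi> i ` (S \<inter> S' \<inter> U i) = \<phi> i ` (S \<inter> U i) \<inter> \<phi> i ` (S' \<inter> U i)"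
      using chart_inj[OF i] by (auto simp: inj_on_def)
    then show "openin (leaf_chart_topology i) (\<phi> i ` (S \<inter> S' \<inter> U i))"
      using S i by auto
  next
    fix \<K> i assume K: "\<forall>S\<in>\<K>. S \<subseteq> topspace X \<and>
      (\<forall>i\<in>I. openin (leaf_chart_topology i) (\<phi> i ` (S \<inter> U i)))" and i: "i \<in> I"
    have "\<phi> i ` (\<Union>\<K> \<inter> U i) = (\<Union>S\<in>\<K>. \<phi> i ` (S \<inter> U i))" by auto
    moreover have "openin (leaf_chart_topology i) (\<Union>S\<in>\<K>. \<phi> i ` (S \<inter> U i))"
      using K i by (intro openin_Union) auto
    ultimately show "openin (leaf_chart_topology i) (\<phi> i ` (\<Union>\<K> \<inter> U i))" by simp
  qed auto
  then have op: "openin (topology P) = P" by (rule topology_inverse')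
  have piece: "P V" if "i \<in> I" "V \<subseteq> U i" "openin (leaf_chart_topology i) (\<phi> i ` V)" for i V
    using leaf_transition_open[OF that(1) _ that(2,3)] that chart_subset unfolding P_def by blast
  have U: "P (U i)" if i: "i \<in> I" for i
  proof (rule piece[OF i order.refl])
    have "\<phi> i ` U i = topspace (leaf_chart_topology i)" using chart_image[OF i] by simp
    then show "openin (leaf_chart_topology i) (\<phi> i ` U i)" by (metis openin_topspace)
  qed
  have top: "topspace (topology P) = topspace X"
  proof
    show "topspace (topology P) \<subseteq> topspace X"
      using openin_topspace[of "topology P"] unfolding op P_def by blast
    have "U i \<subseteq> topspace (topology P)" if "i \<in> I" for i
      using U[OF that] openin_subset[of "topology P"] unfolding op by blast
    then show "topspace X \<subseteq> topspace (topology P)" using cover by blast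
  qed
  have "homeomorphic_map (subtopology (topology P) (U i)) (leaf_chart_topology i) (\<phi> i)"
    if i: "i \<in> I" for i
  proof -
    have ts: "topspace (subtopology (topology P) (U i)) = U i"
      using top chart_subset[OF i] by auto
    have opS: "openin (subtopology (topology P) (U i)) V \<longleftrightarrow>
        V \<subseteq> U i \<and> openin (leaf_chart_topology i) (\<phi> i ` V)" for V
    proof -
      have "openin (subtopology (topology P) (U i)) V \<longleftrightarrow> P V \<and> V \<subseteq> U i"
        using U[OF i] openin_open_subtopology[of "topology P" "U i" V] unfolding op by blast
      also have "\<dots> \<longleftrightarrow> V \<subseteq> U i \<and> openin (leaf_chart_topology i) (\<phi> i ` V)"
        using piece[OF i, of V] i inf.absorb1[of V "U i"] unfolding P_def by auto
      finally show ?thesis .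
    qed
    show ?thesis
    proof (rule bijective_open_imp_homeomorphic_map)
      show "open_map (subtopology (topology P) (U i)) (leaf_chart_topology i) (\<phi> i)"
        unfolding open_map_def using opS by blast
      show "\<phi> i ` topspace (subtopology (topology P) (U i)) = topspace (leaf_chart_topology i)"
        unfolding ts using chart_image[OF i] by simp
      show "inj_on (\<phi> i) (topspace (subtopology (topology P) (U i)))"
        unfolding ts by (rule chart_inj[OF i])
      show "continuous_map (subtopology (topology P) (U i)) (leaf_chart_topology i) (\<phi> i)"
        unfolding continuous_map_def ts
      proof (intro conjI allI impI)
        show "\<phi> i \<in> U i \<rightarrow> topspace (leaf_chart_topology i)"
          using chart_image[OF i] by auto
        fix Q assume Q: "openin (leaf_chart_topology i) Q"
        have "Q \<subseteq> \<phi> i ` U i" using openin_subset[OF Q] chart_image[OF i] by simp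
        then have "\<phi> i ` {x \<in> U i. \<phi> i x \<in> Q} = Q" by auto
        then show "openin (subtopology (topology P) (U i)) {x \<in> U i. \<phi> i x \<in> Q}"
          using opS Q by auto
      qed
    qed
  qed
  then have "is_leaf_topology (topology P)"
    unfolding is_leaf_topology_def using top U by (simp add: op)
  then show "\<exists>L. is_leaf_topology L" by blast
next
  fix L L' assume "is_leaf_topology L" "is_leaf_topology L'"
  then show "L = L'" by (simp add: topology_eq is_leaf_topology_openin)
qed

corollary is_leaf_topology_leaf_topology: "is_leaf_topology leaf_topology"
  unfolding leaf_topology_def by (rule theI'[OF leaf_topology_exists_unique])

end

end

theory Submission
  imports Defs
begin

text \<open>Put \<open>\<mu> B\<close> for the supremum of \<open>\<Lambda> S\<close> over the generalized transversals \<open>S \<subseteq> B\<close>.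
  Generalized transversals form a family of Borel sets that is closed under countable unions and
  under intersections with Borel sets.  Hence the supremum is attained, and \<open>\<mu>\<close> is countably
  additive and extends \<open>\<Lambda>\<close>.\<close>

lemma countably_additive_hereditary_extension:
  fixes N :: "'a measure" and G :: "'a set set" and \<Lambda> :: "'a set \<Rightarrow> ennreal"
  assumes sub: "G \<subseteq> sets N" and empty: "{} \<in> G"
    and UN: "\<And>A :: nat \<Rightarrow> 'a set. range A \<subseteq> G \<Longrightarrow> (\<Union>k. A k) \<in> G"
    and hereditary: "\<And>S B. S \<in> G \<Longrightarrow> B \<in> sets N \<Longrightarrow> S \<inter> B \<in> G"
    and pos: "positive G \<Lambda>" and ca: "countably_additive G \<Lambda>"
  shows "\<exists>M. space M = space N \<and> sets M = sets N \<and> (\<forall>S\<in>G. emeasure M S = \<Lambda> S)"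
proof -
  \<comment> \<open>Monotonicity of \<Lambda> rests on differences staying in \<open>G\<close>. Such
    a difference is a trace on the complement of a measurable set, so \<open>hereditary\<close>
    supplies it.\<close>
  interpret ring_of_sets "space N" G
  proof (rule ring_of_setsI)
    show "G \<subseteq> Pow (space N)" using sub sets.space_closed by blast
  next
    fix a b assume a: "a \<in> G" and b: "b \<in> G"
    show "a \<union> b \<in> G"
      using UN[of "binary a b"] a b by (simp add: range_binary_eq flip: Un_range_binary)
    have "a - b = a \<inter> (space N - b)" using a sub sets.sets_into_space by blast
    then show "a - b \<in> G" using hereditary[OF a, of "space N - b"] b sub by auto
  qed (rule empty)
  have mono: "\<Lambda> S \<le> \<Lambda> S'" if "S \<in> G" "S' \<in> G" "S \<subseteq> S'" for S S'
    using additive_increasing[OF pos countably_additive_additive[OF pos ca]] that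
    by (auto simp: increasing_def)
  define \<mu> where "\<mu> B = (SUP S\<in>{S \<in> G. S \<subseteq> B}. \<Lambda> S)" for B
  have upper: "\<Lambda> S \<le> \<mu> B" if "S \<in> G" "S \<subseteq> B" for S B
    unfolding \<mu>_def using that by (intro SUP_upper) auto
  \<comment> \<open>Among the competitors inside a member \<open>S\<close> of \<open>G\<close>, the
    largest is \<open>S\<close> itself.\<close>
  have agree: "\<mu> S = \<Lambda> S" if "S \<in> G" for S
    unfolding \<mu>_def using that by (intro antisym SUP_least SUP_upper) (auto intro: mono)
  have attained: "\<exists>S\<in>G. S \<subseteq> B \<and> \<Lambda> S = \<mu> B" for B
  proof -
    \<comment> \<open>Since \<open>{}\<close> competes, the supremum is over a nonempty set of
      values and, even when infinite, is that of a sequence of them. The union of the corresponding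
      sets still lies inside \<open>B\<close>, and by \<open>mono\<close> its value dominates the
      whole sequence.\<close>
    have "\<Lambda> ` {S \<in> G. S \<subseteq> B} \<noteq> {}" using empty by blast
    from ennreal_Sup_countable_SUP[OF this] obtain f :: "nat \<Rightarrow> ennreal"
      where f: "range f \<subseteq> \<Lambda> ` {S \<in> G. S \<subseteq> B}" "\<mu> B = (SUP k. f k)"
      unfolding \<mu>_def by metis
    have "\<exists>S. S \<in> G \<and> S \<subseteq> B \<and> f k = \<Lambda> S" for k using f(1) by blast
    then obtain A where A: "\<And>k. A k \<in> G" "\<And>k. A k \<subseteq> B" "\<And>k. f k = \<Lambda> (A k)" by metis
    have G: "(\<Union>k. A k) \<in> G" using UN A(1) by blast
    have "\<mu> B \<le> \<Lambda> (\<Union>k. A k)"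
      unfolding f(2) A(3) using A(1) G by (intro SUP_least mono) auto
    moreover have "\<Lambda> (\<Union>k. A k) \<le> \<mu> B" using upper[OF G] A(2) by blast
    ultimately show ?thesis using G A(2) by (intro bexI[OF _ G]) auto
  qed
  have "countably_additive (sets N) \<mu>"
  proof (rule countably_additiveI)
    fix B :: "nat \<Rightarrow> 'a set"
    assume B: "range B \<subseteq> sets N" and disj: "disjoint_family B"
    \<comment> \<open>Superadditivity: optimal sets chosen in the disjoint pieces are disjoint, so
      their union competes for \<open>\<Union>k. B k\<close> with value the full sum.\<close>
    have "\<forall>k. \<exists>S. S \<in> G \<and> S \<subseteq> B k \<and> \<Lambda> S = \<mu> (B k)" using attained by blast
    then obtain A where A: "\<And>k. A k \<in> G" "\<And>k. A k \<subseteq> B k" "\<And>k. \<Lambda> (A k) = \<mu> (B k)" by metis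
    have GA: "(\<Union>k. A k) \<in> G" using UN A(1) by blast
    have "disjoint_family A" using disj A(2) unfolding disjoint_family_on_def by blast
    then have "(\<Sum>k. \<mu> (B k)) = \<Lambda> (\<Union>k. A k)"
      using ca[unfolded countably_additive_def, rule_format, of A] A GA
      by (auto simp: image_subset_iff)
    also have "\<dots> \<le> \<mu> (\<Union>k. B k)" using A(2) by (intro upper GA) blast
    finally have le: "(\<Sum>k. \<mu> (B k)) \<le> \<mu> (\<Union>k. B k)" .
    \<comment> \<open>Subadditivity: an optimal set for the union is cut along the pieces, and each
      cut competes in its own piece. Nothing is subtracted in either direction, so infinite values
      are covered.\<close>
    obtain S where S: "S \<in> G" "S \<subseteq> (\<Union>k. B k)" "\<Lambda> S = \<mu> (\<Union>k. B k)"
      using attained by blast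
    have SB: "S \<inter> B k \<in> G" for k using hereditary S(1) B by blast
    have eq: "(\<Union>k. S \<inter> B k) = S" using S(2) by blast
    have "disjoint_family (\<lambda>k. S \<inter> B k)" using disj unfolding disjoint_family_on_def by blast
    then have "\<Lambda> S = (\<Sum>k. \<Lambda> (S \<inter> B k))"
      using ca[unfolded countably_additive_def, rule_format, of "\<lambda>k. S \<inter> B k"] SB S(1)
      unfolding eq by (auto simp: image_subset_iff)
    also have "\<dots> \<le> (\<Sum>k. \<mu> (B k))" by (intro suminf_le upper SB) auto
    finally show "(\<Sum>k. \<mu> (B k)) = \<mu> (\<Union>k. B k)" using le S(3) by simp
  qed
  moreover have "positive (sets N) \<mu>"
    using agree[OF empty] pos by (simp add: positive_def)
  \<comment> \<open>\<open>measure_of\<close> falls back to the zero measure unless \<mu> is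
    positive and countably additive on the \<sigma>-algebra, so both facts are required to evaluate
    \<open>emeasure\<close>.\<close>
  ultimately have "emeasure (measure_of (space N) (sets N) \<mu>) S = \<Lambda> S" if "S \<in> G" for S
    using that sub agree
    by (subst emeasure_measure_of_sigma) (auto intro: sets.sigma_algebra_axioms)
  then show ?thesis
    by (intro exI[of _ "measure_of (space N) (sets N) \<mu>"]) simp
qed

theorem theorem1p1:
  fixes X :: "'a topology"
    and n :: nat
    and I :: "'i set"
    and U :: "'i \<Rightarrow> 'a set"
    and T :: "'i \<Rightarrow> 'b topology"
    and \<phi> :: "'i \<Rightarrow> 'a \<Rightarrow> 'b \<times> (nat \<Rightarrow> real)"
    and \<Lambda> :: "'a set \<Rightarrow> ennreal"
  assumes "foliated_space X n I U T \<phi>"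
    and "foliated_space.transverse_invariant_measure X n I U T \<phi> \<Lambda>"
  shows "\<exists>M :: 'a measure. space M = topspace X \<and> sets M = sets (borel_of X) \<and>
    (\<forall>S \<in> foliated_space.generalized_transversals X n I U T \<phi>. emeasure M S = \<Lambda> S)"
proof -
  interpret foliated_space X n I U T \<phi> by fact
  have \<Lambda>: "positive generalized_transversals \<Lambda>" "countably_additive generalized_transversals \<Lambda>"
    using assms(2) by (auto simp: transverse_invariant_measure_def positive_def)
  have "S \<inter> B \<in> generalized_transversals"
    if "S \<in> generalized_transversals" "B \<in> sets (borel_of X)" for S B
  proof -
    \<comment> \<open>Cutting by a Borel set keeps a transversal Borel and can only shrink its
      countable intersection with each leaf.\<close>
    have "countable (S \<inter> B \<inter> F)" if "F \<in> leaves" for F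
      by (rule countable_subset[of _ "S \<inter> F"])
        (use \<open>S \<in> generalized_transversals\<close> that in \<open>auto simp: generalized_transversals_def\<close>)
    then show ?thesis using that by (auto simp: generalized_transversals_def)
  qed
  moreover have "{} \<in> generalized_transversals" "generalized_transversals \<subseteq> sets (borel_of X)"
    by (auto simp: generalized_transversals_def)
  moreover have "space (borel_of X) = topspace X"
    by (simp add: borel_of_def space_measure_of_conv)
  ultimately show ?thesis
    using countably_additive_hereditary_extension[of generalized_transversals "borel_of X" \<Lambda>,
        OF _ _ generalized_transversals_UN _ \<Lambda>]
    by simp
qed

end
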